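(* For every $m\ge 3$ and all integers $k_1,\ldots,k_m\geq 1$, \[ \mathcal{F}(k_1,\ldots,k_m) = \mathcal{F}(k_2-1,k_3,\ldots,k_m) + \mathcal{F}(k_3-1,k_4,\ldots,k_m) \] and \[ \mathcal{F}(k_1,\ldots,k_m) = \mathcal{F}(k_1,\ldots,k_{m-2},k_{m-1}-1) + \mathcal{F}(k_1,\ldots,k_{m-3},k_{m-2}-1). \] (For $m=3$ the last terms on the right-hand sides are $\mathcal{F}(k_3-1)$ and $\mathcal{F}(k_1-1)$, respectively.) Also, $\mathcal{F}(k_1,k_2)=3$ for all integers $k_1,k_2\ge 1$, and $\mathcal{F}(k)=2$ for all integers $k\geq 0$.
   Context: Open chain AND-OR networks. For $n\ge 2$ and operators $\diamondsuit_2,\ldots,\diamondsuit_{n-1}\in\{\wedge,\vee\}$ (logical AND, OR), the AND-OR network with open chain topology is $f=(f_1,\ldots,f_n):\{0,1\}^n\to\{0,1\}^n$ with $f_1(x)=x_2$, $f_i(x)=x_{i-1}\diamondsuit_i x_{i+1}$ for $2\le i\le n-1$, and $f_n(x)=x_{n-1}$. A fixed point is an $x$ with $f(x)=x$. For positive integers $k_1,\ldots,k_m$ with $k_1+\cdots+k_m=n-2$, the sequence $(k_1,\ldots,k_m)$ represents the network whose operator sequence $\diamondsuit_2,\ldots,\diamondsuit_{n-1}$ consists of $m$ consecutive runs of lengths $k_1,\ldots,k_m$, the operator being constant in each run and alternating between $\wedge$ and $\vee$ from one run to the next. $\mathcal{F}(k_1,\ldots,k_m)$ denotes the number of fixed points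 of this network (it does not depend on whether the first run is $\wedge$ or $\vee$). Conventions: the empty sequence $()$ denotes the network $f(x_1,x_2)=(x_2,x_1)$, and $\mathcal{F}()$ is its number of fixed points. A zero entry at either end of a sequence is deleted: $\mathcal{F}(0,k_1,\ldots,k_m,0)=\mathcal{F}(k_1,\ldots,k_m,0)=\mathcal{F}(0,k_1,\ldots,k_m)=\mathcal{F}(k_1,\ldots,k_m)$; in particular $\mathcal{F}(0)=\mathcal{F}()$. *)

theory Defs
  imports Main "HOL-Library.FuncSet"
begin

datatype lop = And | Or

fun apply_lop :: "lop \<Rightarrow> bool \<Rightarrow> bool \<Rightarrow> bool" where
  "apply_lop And a b = (a \<and> b)"
| "apply_lop Or a b = (a \<or> b)"

fun dual :: "lop \<Rightarrow> lop" where
  "dual And = Or"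
| "dual Or = And"

text \<open>States \<open>x \<in> {0,1}\<^sup>n\<close> are extensional functions on \<open>{1..n}\<close>, so that indices agree with
  the usual notation \<open>x\<^sub>1, \<dots>, x\<^sub>n\<close>. Only the values of \<open>d\<close> at \<open>2, \<dots>, n - 1\<close> matter.\<close>

abbreviation states :: "nat \<Rightarrow> (nat \<Rightarrow> bool) set" where
  "states n \<equiv> {1..n} \<rightarrow>\<^sub>E UNIV"

definition open_chain :: "nat \<Rightarrow> (nat \<Rightarrow> lop) \<Rightarrow> (nat \<Rightarrow> bool) \<Rightarrow> (nat \<Rightarrow> bool)" where
  "open_chain n d x = (\<lambda>i\<in>{1..n}.
     if i = 1 then x 2
     else if i = n then x (n - 1)
     else apply_lop (d i) (x (i - 1)) (x (i + 1)))"

definition fixed_points :: "nat \<Rightarrow> (nat \<Rightarrow> lop) \<Rightarrow> (nat \<Rightarrow> bool) set" where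
  "fixed_points n d = {x \<in> states n. open_chain n d x = x}"

fun runs :: "lop \<Rightarrow> nat list \<Rightarrow> lop list" where
  "runs c [] = []"
| "runs c (k # ks) = replicate k c @ runs (dual c) ks"

text \<open>Number of fixed points of the network on \<open>n = k\<^sub>1 + \<cdots> + k\<^sub>m + 2\<close> nodes represented by
  \<open>(k\<^sub>1, \<dots>, k\<^sub>m)\<close> whose first run consists of \<open>c\<close>. The operator list starts at node 2.\<close>

definition num_fixed_points :: "lop \<Rightarrow> nat list \<Rightarrow> nat" where
  "num_fixed_points c ks =
     card (fixed_points (sum_list ks + 2) (\<lambda>i. runs c ks ! (i - 2)))"

definition trim_zeros :: "nat list \<Rightarrow> nat list" where
  "trim_zeros ks = rev (dropWhile ((=) 0) (rev (dropWhile ((=) 0) ks)))"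

text \<open>The choice of \<open>And\<close> for the first run is immaterial by \<open>\<F>_eq\<close> below.\<close>

definition \<F> :: "nat list \<Rightarrow> nat" where
  "\<F> ks = num_fixed_points And (trim_zeros ks)"

lemma dual_dual [simp]: "dual (dual c) = c"
  by (cases c) auto

lemma apply_lop_dual: "apply_lop (dual c) (\<not> a) (\<not> b) = (\<not> apply_lop c a b)"
  by (cases c) auto

lemma length_runs [simp]: "length (runs c ks) = sum_list ks"
  by (induction ks arbitrary: c) auto

lemma runs_dual: "runs (dual c) ks = map dual (runs c ks)"
  by (induction ks arbitrary: c) (auto simp: comp_def)

lemma card_fixed_points_dual_le:
  assumes "n \<ge> 2" and d: "\<And>i. 1 < i \<Longrightarrow> i < n \<Longrightarrow> d' i = dual (d i)"
  shows "card (fixed_points n d) \<le> card (fixed_points n d')"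
proof (rule card_inj_on_le)
  define h :: "(nat \<Rightarrow> bool) \<Rightarrow> nat \<Rightarrow> bool" where "h x = (\<lambda>i\<in>{1..n}. \<not> x i)" for x
  show "inj_on h (fixed_points n d)"
  proof (rule inj_onI)
    fix x y assume "x \<in> fixed_points n d" "y \<in> fixed_points n d" and e: "h x = h y"
    then have xy: "x \<in> states n" "y \<in> states n" by (auto simp: fixed_points_def)
    show "x = y"
    proof (rule PiE_ext[OF xy])
      fix i assume "i \<in> {1..n}"
      with fun_cong[OF e, of i] show "x i = y i" by (simp add: h_def)
    qed
  qed
  show "h ` fixed_points n d \<subseteq> fixed_points n d'"
  proof
    fix y assume "y \<in> h ` fixed_points n d"
    then obtain x where y: "y = h x" and x: "open_chain n d x = x"
      by (auto simp: fixed_points_def)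
    have "open_chain n d' (h x) i = h x i" for i
    proof (cases "i \<in> {1..n}")
      case True
      have xi: "open_chain n d x i = x i" using x by simp
      consider "i = 1" | "i \<noteq> 1" "i = n" | "1 < i" "i < n"
        using True by fastforce
      then show ?thesis
      proof cases
        case 3
        then have "i - 1 \<in> {1..n}" "i + 1 \<in> {1..n}" by auto
        then have "h x (i - 1) = (\<not> x (i - 1))" "h x (i + 1) = (\<not> x (i + 1))" "h x i = (\<not> x i)"
          using True by (simp_all add: h_def)
        then show ?thesis using 3 d[of i] xi
          by (simp add: open_chain_def apply_lop_dual del: One_nat_def)
      qed (use True xi \<open>n \<ge> 2\<close> in \<open>auto simp: open_chain_def h_def\<close>)
    next
      case False
      then show ?thesis by (simp only: open_chain_def h_def restrict_apply if_False)
    qed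
    then show "y \<in> fixed_points n d'"
      by (auto simp: y fixed_points_def h_def)
  qed
  show "finite (fixed_points n d')"
    by (rule finite_subset[of _ "states n"]) (auto simp: fixed_points_def intro!: finite_PiE)
qed

lemma num_fixed_points_dual: "num_fixed_points (dual c) ks = num_fixed_points c ks"
  unfolding num_fixed_points_def
  by (intro antisym card_fixed_points_dual_le) (auto simp: runs_dual)

lemma \<F>_eq: "\<F> ks = num_fixed_points c (trim_zeros ks)"
  using num_fixed_points_dual[of And] by (cases c) (auto simp: \<F>_def)

lemma \<F>_Cons_0 [simp]: "\<F> (0 # ks) = \<F> ks"
  by (simp add: \<F>_def trim_zeros_def)

lemma \<F>_snoc_0 [simp]: "\<F> (ks @ [0]) = \<F> ks"
  by (induction ks) (auto simp: \<F>_def trim_zeros_def)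

end

theory Submission
  imports Defs
begin

text \<open>
  A fixed point is a word \<open>x\<^sub>1 \<dots> x\<^sub>n\<close> with equal first two and equal last two letters in which every
  inner letter is the value of its operator on its two neighbours. Such a word can be read from left
  to right: two consecutive letters \<open>a b\<close> and the operator \<open>d\<close> at \<open>b\<close> restrict the next letter \<open>c\<close> by
  \<open>b = a d c\<close>. If \<open>e\<close> is the neutral element of \<open>d\<close>, the possible steps are \<open>e e \<rightarrow> e\<close> and
  \<open>e (\<not>e) \<rightarrow> \<not>e\<close>, an arbitrary \<open>c\<close> after \<open>(\<not>e) (\<not>e)\<close>, and none after \<open>(\<not>e) e\<close>. Hence, writing
  \<open>N ds a b\<close> for the number of ways to complete a word that starts with \<open>a b\<close> along the operators \<open>ds\<close>,
  a run \<open>d\<^sup>k\<close> with \<open>k \<ge> 1\<close> obeys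
  \<open>N (d\<^sup>k ds) e e = N ds e e\<close> and \<open>N (d\<^sup>k ds) (\<not>e) (\<not>e) = N ds (\<not>e) (\<not>e) + N ds (\<not>e) e\<close>:
  the length of the run is invisible from states in which the two letters agree. The only other
  state that passes a step is \<open>e (\<not>e)\<close>, and it becomes \<open>(\<not>e) (\<not>e)\<close> after one operator. That single
  used-up operator is where the entries \<open>k\<^sub>2 - 1\<close> and \<open>k\<^sub>3 - 1\<close> of the recursion come from.

  Since \<open>\<F>\<close> counts \<open>N ds e e + N ds (\<not>e) (\<not>e)\<close>, applying these rules to the first run, to the second
  (whose neutral element is \<open>\<not>e\<close>) and to the first step of the third gives the recursion at the left end
  (\<open>num_chains_two_runs\<close>, \<open>num_fixed_points_rec\<close>); they also give the values for one and two runs.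
  The recursion at the right end is the mirror image, because reversing
  a fixed point yields a fixed point of the reversed network (\<open>\<F>_rev\<close>). Decremented entries may be
  zero; as an empty run at either end leaves the operator word unchanged up to duality, the
  deletion of zeros never has to be carried out (\<open>\<F>_eq_num_fixed_points\<close>).
\<close>

section \<open>Counting fixed points from left to right\<close>

text \<open>The words \<open>zs\<close> for which \<open>a b zs\<close> satisfies the local condition at \<open>b\<close> and at every later
  letter, where \<open>ds\<close> lists the operators from \<open>b\<close> onwards. No condition is imposed at \<open>a\<close>, so that the
  recursion needs to remember only the last two letters.\<close>

fun continuations :: "lop list \<Rightarrow> bool \<Rightarrow> bool \<Rightarrow> bool list set" where
  "continuations [] a b = (if a = b then {[]} else {})"
| "continuations (d # ds) a b =
     (\<Union>c\<in>{c. b = apply_lop d a c}. (#) c ` continuations ds b c)"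

lemma continuations_iff:
  "zs \<in> continuations ds a b \<longleftrightarrow>
     length zs = length ds \<and>
     (\<forall>i<length ds. (b # zs) ! i = apply_lop (ds ! i) ((a # b # zs) ! i) (zs ! i)) \<and>
     (a # b # zs) ! length ds = (b # zs) ! length ds"
proof (induction ds arbitrary: a b zs)
  case (Cons d ds)
  show ?case
  proof (cases zs)
    case Nil
    then show ?thesis by auto
  next
    case (Cons c ys)
    then have "zs \<in> continuations (d # ds) a b \<longleftrightarrow>
        b = apply_lop d a c \<and> ys \<in> continuations ds b c" by auto
    with Cons show ?thesis by (auto simp: Cons.IH All_less_Suc2)
  qed
qed auto

lemma finite_continuations [simp]: "finite (continuations ds a b)"
  by (induction ds arbitrary: a b) auto

definition num_continuations :: "lop list \<Rightarrow> bool \<Rightarrow> bool \<Rightarrow> nat" where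
  "num_continuations ds a b = card (continuations ds a b)"

lemma num_continuations_Nil: "num_continuations [] a b = (if a = b then 1 else 0)"
  by (simp add: num_continuations_def)

lemma num_continuations_Cons:
  "num_continuations (d # ds) a b =
     (\<Sum>c | b = apply_lop d a c. num_continuations ds b c)"
  by (simp add: num_continuations_def, subst card_UN_disjoint) (auto simp: card_image)

text \<open>The first node copies the second, so a fixed point starts with two equal letters.\<close>

definition num_chains :: "lop list \<Rightarrow> nat" where
  "num_chains ds = num_continuations ds True True + num_continuations ds False False"

text \<open>Allows one to count relative to the neutral element \<open>e\<close> of whichever operator comes first,
  which treats \<open>\<and>\<close> and \<open>\<or>\<close> uniformly.\<close>

lemma num_chains_eq:
  "num_chains ds = num_continuations ds e e + num_continuations ds (\<not> e) (\<not> e)"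
  by (cases e) (auto simp: num_chains_def)

lemma fixed_point_iff:
  assumes "n \<ge> 2"
  shows "x \<in> fixed_points n d \<longleftrightarrow> x \<in> states n \<and> x 1 = x 2 \<and> x n = x (n - 1) \<and>
           (\<forall>i. 1 < i \<and> i < n \<longrightarrow> x i = apply_lop (d i) (x (i - 1)) (x (i + 1)))"
proof -
  have "open_chain n d x = x \<longleftrightarrow> (\<forall>i\<in>{1..n}. open_chain n d x i = x i)" if "x \<in> states n"
  proof
    assume eq: "\<forall>i\<in>{1..n}. open_chain n d x i = x i"
    have "open_chain n d x \<in> states n" by (simp add: open_chain_def)
    from this that show "open_chain n d x = x"
      by (rule PiE_ext) (use eq in blast)
  qed simp
  moreover have "(\<forall>i\<in>{1..n}. open_chain n d x i = x i) \<longleftrightarrow> x 1 = x 2 \<and> x n = x (n - 1) \<and>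
           (\<forall>i. 1 < i \<and> i < n \<longrightarrow> x i = apply_lop (d i) (x (i - 1)) (x (i + 1)))"
    (is "?l \<longleftrightarrow> ?r")
  proof
    assume l: ?l
    then have *: "open_chain n d x i = x i" if "1 \<le> i" "i \<le> n" for i
      using that by simp
    have "x i = apply_lop (d i) (x (i - 1)) (x (i + 1))" if "1 < i" "i < n" for i
      using *[of i] that by (simp add: open_chain_def)
    moreover have "x 1 = x 2" "x n = x (n - 1)"
      using *[of 1] *[of n] assms by (simp_all add: open_chain_def)
    ultimately show ?r by blast
  next
    assume r: ?r
    show ?l
    proof
      fix i assume "i \<in> {1..n}"
      then consider "i = 1" | "i \<noteq> 1" "i = n" | "1 < i" "i < n"
        by fastforce
      then show "open_chain n d x i = x i"
      proof cases
        case 3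
        with r have "x i = apply_lop (d i) (x (i - 1)) (x (i + 1))" by blast
        then have "apply_lop (d i) (x (i - 1)) (x (i + 1)) = x i" ..
        with 3 show ?thesis by (simp add: open_chain_def)
      qed (use r assms in \<open>auto simp: open_chain_def\<close>)
    qed
  qed
  ultimately show ?thesis unfolding fixed_points_def mem_Collect_eq by blast
qed

text \<open>Reading a word as a function on \<open>{1..n}\<close> is a bijection between the words counted by
  \<^const>\<open>num_chains\<close> and the fixed points; the local conditions agree after the shift of indices from
  lists, which start at 0, to nodes, whose first operator sits at node 2.\<close>

lemma card_fixed_points_eq_num_chains:
  "card (fixed_points (length ds + 2) (\<lambda>i. ds ! (i - 2))) = num_chains ds"
proof -
  define n where "n = length ds + 2"
  define F where "F = fixed_points n (\<lambda>i. ds ! (i - 2))"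
  define L where "L e = (\<lambda>zs. e # e # zs) ` continuations ds e e" for e
  define g :: "bool list \<Rightarrow> nat \<Rightarrow> bool" where "g xs = (\<lambda>i\<in>{1..n}. xs ! (i - 1))" for xs
  have L_iff: "xs \<in> L True \<union> L False \<longleftrightarrow> length xs = n \<and> xs ! 0 = xs ! 1 \<and>
      (\<forall>i<length ds. xs ! (i+1) = apply_lop (ds ! i) (xs ! i) (xs ! (i+2))) \<and>
      xs ! (n - 2) = xs ! (n - 1)" for xs
  proof (cases "\<exists>a b zs. xs = a # b # zs")
    case True
    then obtain a b zs where xs: "xs = a # b # zs" by blast
    have "xs \<in> L True \<union> L False \<longleftrightarrow> a = b \<and> zs \<in> continuations ds a b"
      by (cases a; cases b) (auto simp: L_def xs)
    then show ?thesis by (auto simp: continuations_iff xs n_def)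
  next
    case False
    then have "length xs < 2" by (cases xs; cases "tl xs") auto
    with False show ?thesis by (auto simp: L_def n_def)
  qed
  have g_iff: "g xs \<in> F \<longleftrightarrow> xs \<in> L True \<union> L False" if len: "length xs = n" for xs
  proof -
    have "(\<forall>i. 1 < i \<and> i < n \<longrightarrow> g xs i = apply_lop (ds ! (i-2)) (g xs (i-1)) (g xs (i+1)))
        \<longleftrightarrow> (\<forall>i<length ds. g xs (i+2) = apply_lop (ds ! i) (g xs (i+1)) (g xs (i+3)))"
      (is "?l \<longleftrightarrow> ?r")
    proof
      assume l: ?l
      show ?r
      proof (intro allI impI)
        fix i assume "i < length ds"
        with l[rule_format, of "i+2"] show "g xs (i+2) = apply_lop (ds ! i) (g xs (i+1)) (g xs (i+3))"
          by (simp add: n_def numeral_3_eq_3)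
      qed
    next
      assume r: ?r
      show ?l
      proof (intro allI impI)
        fix i assume i: "1 < i \<and> i < n"
        then obtain j where "i = j + 2" by (metis add.commute le_Suc_ex Suc_leI Suc_1)
        with r[rule_format, of j] i
        show "g xs i = apply_lop (ds ! (i-2)) (g xs (i-1)) (g xs (i+1))"
          by (simp add: n_def numeral_3_eq_3)
      qed
    qed
    moreover have "g xs i = xs ! (i - 1)" if "1 \<le> i" "i \<le> n" for i
      using that by (simp add: g_def)
    moreover have "g xs \<in> states n" by (simp add: g_def)
    ultimately show ?thesis unfolding L_iff F_def
      by (subst fixed_point_iff) (auto simp: n_def len)
  qed
  have "bij_betw g (L True \<union> L False) F"
  proof (rule bij_betw_imageI)
    show "inj_on g (L True \<union> L False)"
    proof (rule inj_onI)
      fix xs ys assume xs: "xs \<in> L True \<union> L False" and ys: "ys \<in> L True \<union> L False"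
        and eq: "g xs = g ys"
      have len: "length xs = n" "length ys = n" using xs ys L_iff by blast+
      show "xs = ys"
      proof (rule nth_equalityI)
        fix i assume "i < length xs"
        with fun_cong[OF eq, of "i+1"] show "xs ! i = ys ! i" by (simp add: g_def len)
      qed (simp add: len)
    qed
    show "g ` (L True \<union> L False) = F"
    proof
      show "g ` (L True \<union> L False) \<subseteq> F" using g_iff L_iff by blast
      show "F \<subseteq> g ` (L True \<union> L False)"
      proof
        fix x assume x: "x \<in> F"
        define xs where "xs = map (\<lambda>i. x (i+1)) [0..<n]"
        have "g xs = x"
        proof (rule PiE_ext[of _ "{1..n}" "\<lambda>_. UNIV"])
          show "x \<in> states n" using x by (simp add: F_def fixed_points_def)
        qed (auto simp: g_def xs_def)
        moreover have "length xs = n" by (simp add: xs_def)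
        ultimately show "x \<in> g ` (L True \<union> L False)"
          using g_iff x by blast
      qed
    qed
  qed
  then have "card F = card (L True \<union> L False)" by (simp add: bij_betw_same_card)
  also have "\<dots> = card (L True) + card (L False)"
    by (rule card_Un_disjoint) (auto simp: L_def)
  finally have "card F = card (L True) + card (L False)" .
  moreover have "card (L e) = num_continuations ds e e" for e
    by (auto simp: L_def num_continuations_def card_image inj_on_def)
  ultimately show ?thesis by (simp add: F_def n_def num_chains_def)
qed

lemma num_fixed_points_eq_num_chains: "num_fixed_points c ks = num_chains (runs c ks)"
  using card_fixed_points_eq_num_chains[of "runs c ks"] by (simp add: num_fixed_points_def)

section \<open>Chains through a run\<close>

text \<open>The truth value that is neutral for the operator: true for \<open>\<and>\<close>, false for \<open>\<or>\<close>. Its negation is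
  absorbing.\<close>

definition neutral :: "lop \<Rightarrow> bool" where
  "neutral c \<longleftrightarrow> c = And"

lemma neutral_dual: "neutral (dual c) \<longleftrightarrow> \<not> neutral c"
  by (cases c) (auto simp: neutral_def)

text \<open>The transfer rules for one operator: they solve \<open>b = a c x\<close> for the next letter \<open>x\<close> in each of the four
  states \<open>a b\<close>, using that \<open>e\<close> is neutral and \<open>\<not> e\<close> absorbing for \<open>c\<close>.\<close>

lemma num_continuations_step:
  assumes "neutral c = e"
  shows "num_continuations (c # ds) e e = num_continuations ds e e"
    and "num_continuations (c # ds) e (\<not> e) = num_continuations ds (\<not> e) (\<not> e)"
    and "num_continuations (c # ds) (\<not> e) (\<not> e) =
           num_continuations ds (\<not> e) (\<not> e) + num_continuations ds (\<not> e) e"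
    and "num_continuations (c # ds) (\<not> e) e = 0"
proof -
  have "{x. e = apply_lop c e x} = {e}" "{x. (\<not> e) = apply_lop c e x} = {\<not> e}"
    "{x. (\<not> e) = apply_lop c (\<not> e) x} = {\<not> e, e}" "{x. e = apply_lop c (\<not> e) x} = {}"
    using assms by (cases c; cases e; auto simp: neutral_def)+
  then show "num_continuations (c # ds) e e = num_continuations ds e e"
    "num_continuations (c # ds) e (\<not> e) = num_continuations ds (\<not> e) (\<not> e)"
    "num_continuations (c # ds) (\<not> e) (\<not> e) =
       num_continuations ds (\<not> e) (\<not> e) + num_continuations ds (\<not> e) e"
    "num_continuations (c # ds) (\<not> e) e = 0"
    by (simp_all only: num_continuations_Cons) simp_all
qed

lemma num_continuations_run_neutral:
  assumes "neutral c = e"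
  shows "num_continuations (replicate k c @ ds) e e = num_continuations ds e e"
  by (induction k) (simp_all add: num_continuations_step[OF assms])

text \<open>From two absorbing letters the next letter is free, but inside the run the choice \<open>e\<close> dies at
  the following operator, as no step leaves the state \<open>(\<not>e) e\<close>. Only the last operator of the
  run therefore offers a genuine choice, and the count does not depend on \<open>k\<close>.\<close>

lemma num_continuations_run_absorbing:
  assumes "neutral c = e" and "k \<ge> 1"
  shows "num_continuations (replicate k c @ ds) (\<not> e) (\<not> e) =
           num_continuations ds (\<not> e) (\<not> e) + num_continuations ds (\<not> e) e"
  using assms(2)
proof (induction k rule: dec_induct)
  case (step k)
  then obtain j where "k = Suc j" by (cases k) auto
  with step.IH show ?case by (simp add: num_continuations_step[OF assms(1)])
qed (simp add: num_continuations_step[OF assms(1)])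

text \<open>The first run leads to the states \<open>e e\<close>, \<open>(\<not>e) (\<not>e)\<close> and \<open>(\<not>e) e\<close> in front of the second run.
  For the second run \<open>\<not>e\<close> is neutral: the state \<open>(\<not>e) (\<not>e)\<close> does not notice its length, and
  \<open>(\<not>e) e\<close> turns into \<open>e e\<close> at the cost of one operator. These two together count all chains with the second
  run shortened by one; the remaining state \<open>e e\<close> crosses the whole second run by the
  absorbing rule.\<close>

lemma num_chains_two_runs:
  assumes "neutral c = e" and "k \<ge> 1" and "l \<ge> 1"
  shows "num_chains (replicate k c @ replicate l (dual c) @ ds) =
           num_chains (replicate (l - 1) (dual c) @ ds) +
           num_continuations ds e e + num_continuations ds e (\<not> e)"
proof -
  have d: "neutral (dual c) = (\<not> e)" using assms(1) by (simp add: neutral_dual)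
  let ?D = "replicate l (dual c) @ ds" and ?D' = "replicate (l - 1) (dual c) @ ds"
  have D: "?D = dual c # ?D'" using assms(3) by (cases l) auto
  have "num_chains (replicate k c @ ?D) =
      num_continuations ?D e e + num_continuations ?D (\<not> e) (\<not> e) + num_continuations ?D (\<not> e) e"
    using assms(1,2)
    by (simp add: num_chains_eq[of _ e] num_continuations_run_neutral num_continuations_run_absorbing)
  also have "num_continuations ?D (\<not> e) (\<not> e) = num_continuations ?D' (\<not> e) (\<not> e)"
    by (simp add: num_continuations_run_neutral[OF d])
  also have "num_continuations ?D (\<not> e) e = num_continuations ?D' e e"
    using num_continuations_step(2)[OF d, of ?D'] by (simp add: D)
  also have "num_continuations ?D e e = num_continuations ds e e + num_continuations ds e (\<not> e)"
    using num_continuations_run_absorbing[OF d assms(3), of ds] by simp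
  finally show ?thesis by (simp add: num_chains_eq[of _ e])
qed

text \<open>The two extra terms of \<open>num_chains_two_runs\<close> belong to the states \<open>e e\<close> and \<open>e (\<not>e)\<close> in front of
  the third run, for which \<open>e\<close> is neutral again. Its first operator makes them \<open>e e\<close> and
  \<open>(\<not>e) (\<not>e)\<close>, which is how a chain along the rest of that run begins.\<close>

lemma num_fixed_points_rec:
  assumes "k1 \<ge> 1" "k2 \<ge> 1" "k3 \<ge> 1"
  shows "num_fixed_points c (k1 # k2 # k3 # ks) =
           num_fixed_points (dual c) ((k2 - 1) # k3 # ks) + num_fixed_points c ((k3 - 1) # ks)"
proof -
  let ?R = "runs (dual c) ks"
  have R: "replicate k3 c @ ?R = c # replicate (k3 - 1) c @ ?R"
    using assms(3) by (cases k3) auto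
  show ?thesis
    using num_chains_two_runs[OF refl assms(1,2), of c "replicate k3 c @ ?R"]
    by (simp add: num_fixed_points_eq_num_chains num_chains_eq[of "replicate (k3 - Suc 0) c @ ?R" "neutral c"]
          num_continuations_step[OF refl] R)
qed

lemma num_fixed_points_single: "num_fixed_points c [k] = 2"
proof -
  have "num_continuations (replicate k c @ []) (\<not> neutral c) (\<not> neutral c) = 1"
    by (cases k)
      (use num_continuations_run_absorbing[OF refl, of k c "[]"] in
        \<open>auto simp: num_continuations_Nil\<close>)
  then show ?thesis
    using num_continuations_run_neutral[OF refl, of k c "[]"]
    by (simp add: num_fixed_points_eq_num_chains num_chains_eq[of _ "neutral c"] num_continuations_Nil)
qed

lemma num_fixed_points_pair:
  assumes "k \<ge> 1" "l \<ge> 1"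
  shows "num_fixed_points c [k, l] = 3"
  using num_chains_two_runs[OF refl assms, of c "[]"] num_fixed_points_single[of "dual c" "l - 1"]
  by (simp add: num_fixed_points_eq_num_chains num_continuations_Nil)

section \<open>Zero entries and reversal\<close>

lemma num_fixed_points_Cons_0: "num_fixed_points c (0 # ks) = num_fixed_points c ks"
  using num_fixed_points_dual[of c ks] by (simp add: num_fixed_points_eq_num_chains)

lemma runs_append: "runs c (ks @ ls) = runs c ks @ runs ((dual ^^ length ks) c) ls"
  by (induction ks arbitrary: c) (auto simp: funpow_swap1)

lemma num_fixed_points_snoc_0: "num_fixed_points c (ks @ [0]) = num_fixed_points c ks"
  by (simp add: num_fixed_points_eq_num_chains runs_append)

text \<open>A zero at the left end shifts the alternation by one run and so only dualises the network; a
  zero at the right end does not change the operator word at all.\<close>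

lemma \<F>_eq_num_fixed_points: "\<F> ks = num_fixed_points c ks"
proof -
  have left: "num_fixed_points c (dropWhile ((=) 0) ks) = num_fixed_points c ks" for ks
    by (induction ks) (auto simp: num_fixed_points_Cons_0)
  have right: "num_fixed_points c (rev (dropWhile ((=) 0) ks)) = num_fixed_points c (rev ks)" for ks
    by (induction ks) (auto simp: num_fixed_points_snoc_0)
  show ?thesis by (simp add: \<F>_eq[of _ c] trim_zeros_def left right)
qed

text \<open>The operator \<open>(dual ^^ Suc (length ks)) c\<close> is that of the last run: dualising once per step from
  the first run would take \<open>length ks - 1\<close> steps, and two further dualisations cancel while avoiding
  the subtraction.\<close>

lemma rev_runs: "rev (runs c ks) = runs ((dual ^^ Suc (length ks)) c) (rev ks)"
proof (induction ks arbitrary: c)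
  case (Cons k ks)
  have "(dual ^^ l) ((dual ^^ l) c) = c" for l c
    by (induction l arbitrary: c) (simp_all add: funpow_swap1)
  with Cons show ?case by (simp add: runs_append funpow_swap1)
qed simp

text \<open>Mirroring a state is injective and, since both operators are commutative, preserves the fixed
  point conditions. The inequality suffices, as mirroring twice is the identity.\<close>

lemma card_fixed_points_rev_le:
  assumes "n \<ge> 2" and d: "\<And>i. 1 < i \<Longrightarrow> i < n \<Longrightarrow> d' i = d (n + 1 - i)"
  shows "card (fixed_points n d) \<le> card (fixed_points n d')"
proof (rule card_inj_on_le)
  define h :: "(nat \<Rightarrow> bool) \<Rightarrow> nat \<Rightarrow> bool" where "h x = (\<lambda>i\<in>{1..n}. x (n + 1 - i))" for x
  have h: "h x i = x (n + 1 - i)" if "1 \<le> i" "i \<le> n" for x i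
    using that by (simp add: h_def)
  show "inj_on h (fixed_points n d)"
  proof (rule inj_onI)
    fix x y assume "x \<in> fixed_points n d" "y \<in> fixed_points n d" and e: "h x = h y"
    then have xy: "x \<in> states n" "y \<in> states n" by (auto simp: fixed_points_def)
    show "x = y"
    proof (rule PiE_ext[OF xy])
      fix i assume "i \<in> {1..n}"
      then have "1 \<le> n + 1 - i" "n + 1 - i \<le> n" "n + 1 - (n + 1 - i) = i" by auto
      with fun_cong[OF e, of "n + 1 - i"] show "x i = y i" by (simp only: h)
    qed
  qed
  show "h ` fixed_points n d \<subseteq> fixed_points n d'"
  proof
    fix y assume "y \<in> h ` fixed_points n d"
    then obtain x where y: "y = h x" and x: "x \<in> fixed_points n d" by auto
    note x = x[unfolded fixed_point_iff[OF \<open>n \<ge> 2\<close>]]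
    have inner: "h x i = apply_lop (d' i) (h x (i - 1)) (h x (i + 1))" if i: "1 < i" "i < n" for i
    proof -
      have eqs: "n + 1 - (i - 1) = n + 1 - i + 1" "n + 1 - (i + 1) = n + 1 - i - 1"
        using i by auto
      have "1 < n + 1 - i \<and> n + 1 - i < n" using i by auto
      with x have "x (n + 1 - i) =
          apply_lop (d (n + 1 - i)) (x (n + 1 - i - 1)) (x (n + 1 - i + 1))" by blast
      also have "\<dots> = apply_lop (d (n + 1 - i)) (x (n + 1 - i + 1)) (x (n + 1 - i - 1))"
        by (cases "d (n + 1 - i)") auto
      finally show ?thesis
        using i h[of i x] h[of "i - 1" x] h[of "i + 1" x] by (simp only: eqs d)
    qed
    have "h x 1 = h x 2" "h x n = h x (n - 1)"
      using x \<open>n \<ge> 2\<close> by (auto simp: h numeral_2_eq_2)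
    moreover have "h x \<in> states n" by (simp add: h_def)
    ultimately show "y \<in> fixed_points n d'"
      unfolding y fixed_point_iff[OF \<open>n \<ge> 2\<close>] using inner by blast
  qed
  show "finite (fixed_points n d')"
    by (rule finite_subset[of _ "states n"]) (auto simp: fixed_points_def intro!: finite_PiE)
qed

lemma num_chains_rev: "num_chains (rev ds) = num_chains ds"
proof -
  have "num_chains ds \<le> num_chains (rev ds)" for ds
    using card_fixed_points_rev_le[of "length ds + 2" "\<lambda>i. rev ds ! (i - 2)" "\<lambda>i. ds ! (i - 2)"]
    by (simp add: rev_nth flip: card_fixed_points_eq_num_chains)
  from this[of ds] this[of "rev ds"] show ?thesis by simp
qed

lemma \<F>_rev: "\<F> (rev ks) = \<F> ks"
  using num_chains_rev[of "runs And ks"]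
  by (simp only: rev_runs flip: num_fixed_points_eq_num_chains \<F>_eq_num_fixed_points)

section \<open>The recursion\<close>

lemma \<F>_rec_left:
  assumes "k1 \<ge> 1" "k2 \<ge> 1" "k3 \<ge> 1"
  shows "\<F> (k1 # k2 # k3 # ks) = \<F> ((k2 - 1) # k3 # ks) + \<F> ((k3 - 1) # ks)"
  using num_fixed_points_rec[OF assms, of And ks]
  by (simp only: flip: \<F>_eq_num_fixed_points)

lemma \<F>_rec_right:
  assumes "k1 \<ge> 1" "k2 \<ge> 1" "k3 \<ge> 1"
  shows "\<F> (ks @ [k3, k2, k1]) = \<F> (ks @ [k3, k2 - 1]) + \<F> (ks @ [k3 - 1])"
  using \<F>_rec_left[OF assms, of "rev ks"] \<F>_rev[of "ks @ [k3, k2, k1]"]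
    \<F>_rev[of "ks @ [k3, k2 - 1]"] \<F>_rev[of "ks @ [k3 - 1]"]
  by simp

theorem theorem2p6:
  shows "(\<forall>(m::nat)\<ge>3. \<forall>k::nat \<Rightarrow> nat. (\<forall>i\<in>{1..m}. k i \<ge> 1) \<longrightarrow>
           \<F> (map k [1..<m+1]) =
             \<F> ((k 2 - 1) # map k [3..<m+1]) + \<F> ((k 3 - 1) # map k [4..<m+1]) \<and>
           \<F> (map k [1..<m+1]) =
             \<F> (map k [1..<m-1] @ [k (m-1) - 1]) + \<F> (map k [1..<m-2] @ [k (m-2) - 1])) \<and>
         (\<forall>(k\<^sub>1::nat)\<ge>1. \<forall>(k\<^sub>2::nat)\<ge>1. \<F> [k\<^sub>1, k\<^sub>2] = 3) \<and>
         (\<forall>k::nat. \<F> [k] = 2)"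
proof (intro conjI allI impI)
  fix m :: nat and k :: "nat \<Rightarrow> nat"
  assume m: "m \<ge> 3" and k: "\<forall>i\<in>{1..m}. k i \<ge> 1"
  have upt: "[1..<m+1] = 1 # [2..<m+1]" "[2..<m+1] = 2 # [3..<m+1]" "[3..<m+1] = 3 # [4..<m+1]"
    using m upt_conv_Cons[of 1 "m+1"] upt_conv_Cons[of 2 "m+1"] upt_conv_Cons[of 3 "m+1"]
    by (simp_all del: upt_Suc add: eval_nat_numeral)
  then have "map k [1..<m+1] = k 1 # k 2 # k 3 # map k [4..<m+1]"
    by (simp only: list.map)
  then show "\<F> (map k [1..<m+1]) =
      \<F> ((k 2 - 1) # map k [3..<m+1]) + \<F> ((k 3 - 1) # map k [4..<m+1])"
    using \<F>_rec_left[of "k 1" "k 2" "k 3"] m k upt(3) by (simp del: upt_Suc)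
  obtain j where j: "m = j + 3" using m by (metis le_Suc_ex add.commute)
  have "map k [1..<m+1] = map k [1..<m-2] @ [k (m-2), k (m-1), k m]"
    and "map k [1..<m-1] = map k [1..<m-2] @ [k (m-2)]"
    by (simp_all add: j numeral_3_eq_3)
  then show "\<F> (map k [1..<m+1]) =
      \<F> (map k [1..<m-1] @ [k (m-1) - 1]) + \<F> (map k [1..<m-2] @ [k (m-2) - 1])"
    using \<F>_rec_right[of "k m" "k (m-1)" "k (m-2)"] m k by simp
qed (simp_all add: \<F>_eq_num_fixed_points[of _ And] num_fixed_points_pair num_fixed_points_single)

end
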